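(* Let $F\subset\mathbb{R}^n$ be a nonempty compact convex set with $0\in\operatorname{int}(F)$ and Minkowski gauge $\rho_F$. Let $A=\{a^1,\ldots,a^m\}\subset\mathbb{R}^n$ be a finite set of demand points, with $m\ge 2$, and let $k$ be an integer with $1\le k\le m$. Consider the generalized multi-source Weber problem of minimizing $$f_F(x)=\sum_{i=1}^m\Big(\min_{\ell=1,\ldots,k}\rho_F(x^\ell-a^i)\Big)$$ over all $x=(x^1,\ldots,x^k)\in(\mathbb{R}^n)^k=\mathbb{R}^{nk}$. Then the set $S_F$ of global optimal solutions (global minimizers of $f_F$ over $\mathbb{R}^{nk}$) is nonempty and closed.
   Context: For a nonempty compact convex set $F\subset\mathbb{R}^n$ with $0\in\operatorname{int}(F)$, the Minkowski function (gauge) is $\rho_F(x)=\inf\{t\ge 0\mid x\in tF\}$, $x\in\mathbb{R}^n$. Note that $F$ is not assumed symmetric, so $\rho_F(x)\ne\rho_F(-x)$ in general. *)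

theory Defs
  imports "HOL-Analysis.Analysis"
begin

definition minkowski_gauge :: "(real ^ 'n) set \<Rightarrow> real ^ 'n \<Rightarrow> real" where
  "minkowski_gauge F x = Inf {t. t \<ge> 0 \<and> x \<in> (\<lambda>y. t *\<^sub>R y) ` F}"

(* A point x of (R^n)^k is a k-indexed vector of points of R^n (k = CARD('k)), and
   x $ l is the l-th centre. The norm, hence the topology, on this type is the
   Euclidean one of R^(nk). *)
definition weber_objective ::
    "(real ^ 'n) set \<Rightarrow> nat \<Rightarrow> (nat \<Rightarrow> real ^ 'n) \<Rightarrow> real ^ 'n ^ 'k \<Rightarrow> real" where
  "weber_objective F m a x =
     (\<Sum>i = 1..m. Min (range (\<lambda>l. minkowski_gauge F (x $ l - a i))))"

definition weber_solutions ::
    "(real ^ 'n) set \<Rightarrow> nat \<Rightarrow> (nat \<Rightarrow> real ^ 'n) \<Rightarrow> (real ^ 'n ^ 'k) set" where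
  "weber_solutions F m a =
     {x. \<forall>y :: real ^ 'n ^ 'k. weber_objective F m a x \<le> weber_objective F m a y}"

end

theory Submission
  imports Defs
begin

text \<open>
  The gauge is comparable to the Euclidean norm and subadditive, hence Lipschitz, so the objective
  is continuous and its set of minimisers is closed. The objective need not be coercive, since a
  single centre may escape to infinity at bounded cost; but a centre far from all demand points may be
  moved to the first demand point without increasing any summand, so it suffices to minimise
  over a compact product of balls.
\<close>

lemma minkowski_gauge_le:
  assumes "t \<ge> 0" "y \<in> F"
  shows "minkowski_gauge F (t *\<^sub>R y) \<le> t"
  unfolding minkowski_gauge_def
  by (rule cInf_lower) (use assms in \<open>auto intro!: bdd_belowI[where m = 0]\<close>)

text \<open>Rescaling \<open>x\<close> to norm \<open>r\<close> puts it in the ball inside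
  \<open>F\<close>. Besides the upper bound on the gauge, this gives the nonemptiness without which
  the real \<open>Inf\<close> could not be bounded from below.\<close>

lemma norm_divide_mem_gauge_scalings:
  assumes "r > 0" "cball 0 r \<subseteq> F"
  shows "norm x / r \<in> {t. t \<ge> 0 \<and> x \<in> (\<lambda>y. t *\<^sub>R y) ` F}"
proof (cases "x = 0")
  case True
  have "0 \<in> F" using assms by auto
  then show ?thesis using True by force
next
  case False
  have "(r / norm x) *\<^sub>R x \<in> F"
    using assms False by (intro subsetD[OF assms(2)]) auto
  moreover have "x = (norm x / r) *\<^sub>R ((r / norm x) *\<^sub>R x)"
    using assms False by simp
  ultimately show ?thesis using assms(1) by (auto simp del: scaleR_scaleR)
qed

lemma minkowski_gauge_le_norm:
  assumes "r > 0" "cball 0 r \<subseteq> F"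
  shows "minkowski_gauge F x \<le> norm x / r"
  unfolding minkowski_gauge_def
  by (rule cInf_lower[OF norm_divide_mem_gauge_scalings[OF assms]])
     (auto intro!: bdd_belowI[where m = 0])

text \<open>If \<open>x = t *\<^sub>R y\<close> with \<open>y\<close> in \<open>F\<close>, then
  \<open>norm x \<le> t * R\<close>, so every admissible \<open>t\<close> is at least
  \<open>norm x / R\<close>. The inner ball ensures that some \<open>t\<close> is
  admissible.\<close>

lemma norm_le_minkowski_gauge:
  assumes "r > 0" "cball 0 r \<subseteq> F" "R > 0" "F \<subseteq> cball 0 R"
  shows "norm x / R \<le> minkowski_gauge F x"
  unfolding minkowski_gauge_def
proof (rule cInf_greatest)
  show "{t. t \<ge> 0 \<and> x \<in> (\<lambda>y. t *\<^sub>R y) ` F} \<noteq> {}"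
    using norm_divide_mem_gauge_scalings[OF assms(1,2)] by blast
next
  fix t assume "t \<in> {t. t \<ge> 0 \<and> x \<in> (\<lambda>y. t *\<^sub>R y) ` F}"
  then obtain y where y: "t \<ge> 0" "y \<in> F" "x = t *\<^sub>R y" by auto
  then have "norm y \<le> R" using assms(4) by auto
  then show "norm x / R \<le> t"
    using y assms(3) by (simp add: divide_le_eq mult_left_mono)
qed

text \<open>For \<open>x = t *\<^sub>R u\<close> and \<open>y = s *\<^sub>R v\<close>, the sum is
  \<open>t + s\<close> times a convex combination of \<open>u\<close> and \<open>v\<close>, so
  \<open>t + s\<close> is admissible for \<open>x + y\<close>.\<close>

lemma minkowski_gauge_triangle:
  assumes "r > 0" "cball 0 r \<subseteq> F" "convex F"
  shows "minkowski_gauge F (x + y) \<le> minkowski_gauge F x + minkowski_gauge F y"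
proof -
  let ?S = "\<lambda>x. {t. t \<ge> 0 \<and> x \<in> (\<lambda>y. t *\<^sub>R y) ` F}"
  have ne: "?S z \<noteq> {}" for z
    using norm_divide_mem_gauge_scalings[OF assms(1,2)] by blast
  have *: "minkowski_gauge F (x + y) \<le> t + s" if t: "t \<in> ?S x" and s: "s \<in> ?S y" for t s
  proof -
    obtain u v where u: "t \<ge> 0" "u \<in> F" "x = t *\<^sub>R u" and v: "s \<ge> 0" "v \<in> F" "y = s *\<^sub>R v"
      using t s by auto
    show ?thesis
    proof (cases "t + s = 0")
      \<comment> \<open>The convex weights would divide by zero here, but both vectors vanish and
        the gauge of 0 is at most 0.\<close>
      case True
      then have "t = 0" "s = 0" using u v by linarith+
      then show ?thesis using minkowski_gauge_le[of 0 u F] u v by simp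
    next
      case False
      then have pos: "t + s > 0" using u v by linarith
      have "(t / (t + s)) *\<^sub>R u + (s / (t + s)) *\<^sub>R v \<in> F"
        using pos u v by (intro convexD[OF assms(3)]) (auto simp: add_divide_distrib[symmetric])
      from minkowski_gauge_le[OF less_imp_le[OF pos] this]
      show ?thesis using pos u v by (simp add: scaleR_add_right)
    qed
  qed
  \<comment> \<open>The two infima are taken one after the other: first over \<open>t\<close> with
    \<open>s\<close> fixed, then over \<open>s\<close>.\<close>
  have "minkowski_gauge F (x + y) - s \<le> minkowski_gauge F x" if s: "s \<in> ?S y" for s
    unfolding minkowski_gauge_def[of F x]
    by (rule cInf_greatest[OF ne]) (use *[OF _ s] in \<open>simp add: diff_le_eq\<close>)
  then have "minkowski_gauge F (x + y) - minkowski_gauge F x \<le> s" if "s \<in> ?S y" for s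
    using that by (smt (verit))
  then have "minkowski_gauge F (x + y) - minkowski_gauge F x \<le> minkowski_gauge F y"
    unfolding minkowski_gauge_def[of F y]
    by (rule cInf_greatest[OF ne])
  then show ?thesis by simp
qed

lemma continuous_on_minkowski_gauge:
  assumes "r > 0" "cball 0 r \<subseteq> F" "convex F"
  shows "continuous_on UNIV (minkowski_gauge F)"
proof -
  \<comment> \<open>The gauge may be asymmetric, but this bound is symmetric in \<open>x\<close> and
    \<open>y\<close>, so swapping them bounds the absolute value.\<close>
  have *: "minkowski_gauge F x - minkowski_gauge F y \<le> norm (x - y) / r" for x y
    using minkowski_gauge_triangle[OF assms, of "x - y" y]
      minkowski_gauge_le_norm[OF assms(1,2), of "x - y"] by simp
  have "(1 / r)-lipschitz_on UNIV (minkowski_gauge F)"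
  proof (rule lipschitz_onI)
    fix x y
    show "dist (minkowski_gauge F x) (minkowski_gauge F y) \<le> 1 / r * dist x y"
      using *[of x y] *[of y x] by (simp add: dist_norm norm_minus_commute abs_le_iff)
  qed (use assms(1) in simp)
  then show ?thesis by (rule lipschitz_on_continuous_on)
qed

lemma continuous_on_Min_image:
  fixes g :: "'i \<Rightarrow> 'a::topological_space \<Rightarrow> real"
  assumes "finite I" "I \<noteq> {}" "\<And>i. i \<in> I \<Longrightarrow> continuous_on S (g i)"
  shows "continuous_on S (\<lambda>x. Min ((\<lambda>i. g i x) ` I))"
  using assms
proof (induction I rule: finite_ne_induct)
  case (insert i I)
  then show ?case by (auto intro!: continuous_on_min)
qed simp

lemma continuous_on_weber_objective:
  assumes "r > 0" "cball 0 r \<subseteq> F" "convex F"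
  shows "continuous_on UNIV (weber_objective F m a :: real ^ 'n ^ 'k::finite \<Rightarrow> real)"
  unfolding weber_objective_def
  by (intro continuous_on_sum continuous_on_Min_image
        continuous_on_compose2[OF continuous_on_minkowski_gauge[OF assms]] continuous_intros)
     auto

text \<open>The minimum for \<open>x\<close> lies below its \<open>l\<close>-th entry, hence below
  the \<open>l\<close>-th entry for \<open>y\<close>, for every \<open>l\<close>. This lets centres
  be replaced independently of each other.\<close>

lemma weber_objective_mono:
  fixes x y :: "real ^ 'n ^ 'k::finite"
  assumes "\<And>i l. i \<in> {1..m} \<Longrightarrow>
    minkowski_gauge F (x $ l - a i) \<le> minkowski_gauge F (y $ l - a i)"
  shows "weber_objective F m a x \<le> weber_objective F m a y"
  unfolding weber_objective_def
proof (rule sum_mono)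
  fix i assume i: "i \<in> {1..m}"
  show "Min (range (\<lambda>l. minkowski_gauge F (x $ l - a i)))
      \<le> Min (range (\<lambda>l. minkowski_gauge F (y $ l - a i)))"
    by (rule Min.boundedI) (use assms[OF i] in \<open>auto simp: Min_le_iff\<close>)
qed

text \<open>The gauge grows at least like \<open>norm / R\<close>, so it exceeds the finitely many
  fixed values at \<open>p - a i\<close> once \<open>z\<close> is far out. The bound
  \<open>M \<ge> norm p\<close> keeps the replacement \<open>p\<close> inside the ball.\<close>

lemma far_point_gauge_ge:
  fixes a :: "nat \<Rightarrow> real ^ 'n"
  assumes "r > 0" "cball 0 r \<subseteq> F" "R > 0" "F \<subseteq> cball 0 R"
  obtains M where "M \<ge> norm p"
    "\<And>i z. i \<in> {1..m} \<Longrightarrow> norm z > M \<Longrightarrow>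
      minkowski_gauge F (p - a i) \<le> minkowski_gauge F (z - a i)"
proof
  \<comment> \<open>By the reverse triangle inequality, \<open>norm z \<ge> b i\<close> forces
    \<open>norm (z - a i) \<ge> R * minkowski_gauge F (p - a i)\<close>. As the \<open>b i\<close>
    are nonnegative, their sum dominates each of them.\<close>
  define b where "b i = norm (a i) + R * minkowski_gauge F (p - a i)" for i
  have b: "b i \<ge> 0" for i
  proof -
    have "0 \<le> norm (p - a i) / R" using assms(3) by simp
    also have "\<dots> \<le> minkowski_gauge F (p - a i)"
      by (rule norm_le_minkowski_gauge[OF assms])
    finally show ?thesis using assms(3) by (simp add: b_def)
  qed
  let ?M = "norm p + (\<Sum>i=1..m. b i)"
  show "?M \<ge> norm p" using b by (simp add: sum_nonneg)
  fix i :: nat and z :: "real ^ 'n" assume i: "i \<in> {1..m}" and z: "norm z > ?M"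
  have "b i \<le> (\<Sum>i=1..m. b i)"
    using i b by (intro member_le_sum) auto
  then have "b i \<le> norm z" using z norm_ge_zero[of p] by linarith
  then have "R * minkowski_gauge F (p - a i) \<le> norm (z - a i)"
    using norm_triangle_ineq2[of z "a i"] by (simp add: b_def)
  then have "minkowski_gauge F (p - a i) \<le> norm (z - a i) / R"
    using assms(3) by (simp add: field_simps)
  also have "\<dots> \<le> minkowski_gauge F (z - a i)"
    by (rule norm_le_minkowski_gauge[OF assms])
  finally show "minkowski_gauge F (p - a i) \<le> minkowski_gauge F (z - a i)" .
qed

lemma compact_cart_cball:
  "compact {x :: real ^ 'n ^ 'k::finite. \<forall>l. x $ l \<in> cball 0 M}"
proof -
  have "{x :: real ^ 'n ^ 'k. \<forall>l. x $ l \<in> cball 0 M} = (\<Inter>l. (\<lambda>x. x $ l) -` cball 0 M)"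
    by auto
  moreover have "closed ((\<lambda>x :: real ^ 'n ^ 'k. x $ l) -` cball 0 M)" for l
    by (intro closed_vimage continuous_intros) auto
  ultimately have "closed {x :: real ^ 'n ^ 'k. \<forall>l. x $ l \<in> cball 0 M}" by auto
  moreover have "bounded {x :: real ^ 'n ^ 'k. \<forall>l. x $ l \<in> cball 0 M}"
  proof (rule boundedI)
    fix x :: "real ^ 'n ^ 'k" assume x: "x \<in> {x. \<forall>l. x $ l \<in> cball 0 M}"
    have "norm x \<le> (\<Sum>l\<in>UNIV. norm (x $ l))"
      unfolding norm_vec_def by (rule L2_set_le_sum) simp
    also have "\<dots> \<le> (\<Sum>l\<in>(UNIV :: 'k set). M)"
      using x by (intro sum_mono) auto
    finally show "norm x \<le> (\<Sum>l\<in>(UNIV :: 'k set). M)" .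
  qed
  ultimately show ?thesis by (simp add: compact_eq_bounded_closed)
qed

theorem theorem3p3:
  fixes F :: "(real ^ 'n) set"
    and a :: "nat \<Rightarrow> real ^ 'n"
    and m :: nat
  assumes "F \<noteq> {}" and "compact F" and "convex F" and "0 \<in> interior F"
    and "m \<ge> 2"
    and "1 \<le> CARD('k::finite)" and "CARD('k) \<le> m"
  shows "(weber_solutions F m a :: (real ^ 'n ^ 'k) set) \<noteq> {} \<and>
         closed (weber_solutions F m a :: (real ^ 'n ^ 'k) set)"
proof -
  let ?f = "weber_objective F m a :: real ^ 'n ^ 'k \<Rightarrow> real"
  obtain r where r: "r > 0" "cball 0 r \<subseteq> F"
    using assms(4) by (auto simp: mem_interior_cball)
  obtain R where R: "R > 0" "F \<subseteq> cball 0 R"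
    using compact_imp_bounded[OF assms(2)] by (force simp: bounded_pos subset_iff)
  have cont: "continuous_on UNIV ?f"
    by (rule continuous_on_weber_objective[OF r assms(3)])
  obtain M where M: "M \<ge> norm (a 1)"
    "\<And>i z. i \<in> {1..m} \<Longrightarrow> norm z > M \<Longrightarrow>
      minkowski_gauge F (a 1 - a i) \<le> minkowski_gauge F (z - a i)"
    using far_point_gauge_ge[OF r R, where p = "a 1" and m = m and a = a] by blast
  let ?K = "{x :: real ^ 'n ^ 'k. \<forall>l. x $ l \<in> cball 0 M}"
  have "(\<chi> l. a 1) \<in> ?K" using M(1) by simp
  then obtain x where x: "x \<in> ?K" "\<And>y. y \<in> ?K \<Longrightarrow> ?f x \<le> ?f y"
    using continuous_attains_inf[OF compact_cart_cball _ continuous_on_subset[OF cont subset_UNIV]]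
    by blast
  have "?f x \<le> ?f y" for y
  proof -
    \<comment> \<open>Centres inside the ball stay, so their gauges are unchanged; the others move
      to \<open>a 1\<close>, which by the choice of \<open>M\<close> raises no gauge.\<close>
    define y' where "y' = (\<chi> l. if norm (y $ l) \<le> M then y $ l else a 1)"
    have "y' \<in> ?K" using M(1) by (simp add: y'_def)
    then have "?f x \<le> ?f y'" by (rule x(2))
    also have "\<dots> \<le> ?f y"
      by (rule weber_objective_mono) (use M(2) in \<open>auto simp: y'_def\<close>)
    finally show ?thesis .
  qed
  then have "x \<in> weber_solutions F m a" by (simp add: weber_solutions_def)
  \<comment> \<open>The solution set is the intersection over all \<open>y\<close> of the sublevel
    sets of \<open>?f\<close> at height \<open>?f y\<close>, each closed by continuity.\<close>
  moreover have "closed (weber_solutions F m a :: (real ^ 'n ^ 'k) set)"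
    unfolding weber_solutions_def
    by (intro closed_Collect_all closed_Collect_le cont continuous_on_const)
  ultimately show ?thesis by blast
qed

end
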